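(* Let $M\ge1$ and $\ell\ge 1$ be integers, let $\tau_0\cdots\tau_{\ell-1}\in\{0,\ldots,M\}^{\ell}$ be a finite word, and let $(\tau_i)_{i=0}^\infty$ be the infinite sequence obtained by the recursive formula $$\tau_{2^n\ell}\cdots\tau_{2^{n+1}\ell-1}:=\overline{\tau_0\cdots\tau_{2^n\ell-1}},\quad n=0,1,\ldots.$$ Then every finite (nonempty) word $\delta$ in $(\tau_i)_{i=0}^{\infty}$ has a density $$d(\delta):=\lim_{r\to\infty}\frac{N^{\delta}(\tau_0\cdots\tau_{r-1})}{r}.$$ Moreover, for every integer $n\ge 0$ satisfying $4^n\ell\ge |\delta|-1$ we have $$d(\delta)=d(\overline{\delta})=\frac{P-N}{6\cdot 4^n\ell}$$ with $$N=N^\delta(\tau_0\cdots\tau_{4^n\ell-1})+N^{\overline{\delta}}(\tau_0\cdots\tau_{4^n\ell-1})$$ and $$P=N^\delta(\tau_0\cdots\tau_{4^{n+1}\ell-1})+N^{\overline{\delta}}(\tau_0\cdots\tau_{4^{n+1}\ell-1}).$$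
   Context: The reflection of a word $w=c_1\cdots c_n$ over the alphabet $\{0,\ldots,M\}$ is $\overline{w}=(M-c_1)\cdots(M-c_n)$. $|\delta|$ denotes the length of the word $\delta$. $N^\delta(\epsilon)$ denotes the number of (possibly overlapping) occurrences of the word $\delta$ as a block of consecutive letters in the word $\epsilon$ (it is $0$ if $|\delta|>|\epsilon|$). $d(\overline\delta)$ is defined by the same limit formula as $d(\delta)$, with $\overline\delta$ in place of $\delta$. *)

theory Defs
  imports Complex_Main
begin

definition reflection :: "nat \<Rightarrow> nat list \<Rightarrow> nat list" where
  "reflection M w = map (\<lambda>c. M - c) w"

definition seq_prefix :: "(nat \<Rightarrow> 'a) \<Rightarrow> nat \<Rightarrow> 'a list" where
  "seq_prefix \<tau> r = map \<tau> [0..<r]"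

definition occurrences :: "'a list \<Rightarrow> 'a list \<Rightarrow> nat" where
  "occurrences \<delta> \<epsilon> =
     card {i. i + length \<delta> \<le> length \<epsilon> \<and> take (length \<delta>) (drop i \<epsilon>) = \<delta>}"

definition word_in :: "'a list \<Rightarrow> (nat \<Rightarrow> 'a) \<Rightarrow> bool" where
  "word_in \<delta> \<tau> \<longleftrightarrow> (\<exists>i. \<delta> = map \<tau> [i..<i + length \<delta>])"

definition frequency :: "(nat \<Rightarrow> 'a) \<Rightarrow> 'a list \<Rightarrow> nat \<Rightarrow> real" where
  "frequency \<tau> \<delta> r = real (occurrences \<delta> (seq_prefix \<tau> r)) / real r"

definition has_density :: "(nat \<Rightarrow> 'a) \<Rightarrow> 'a list \<Rightarrow> bool" where
  "has_density \<tau> \<delta> \<longleftrightarrow> convergent (frequency \<tau> \<delta>)"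

text \<open>Meaningful only when \<open>has_density\<close> holds, since \<open>lim\<close> is total.\<close>
definition density :: "(nat \<Rightarrow> 'a) \<Rightarrow> 'a list \<Rightarrow> real" where
  "density \<tau> \<delta> = lim (frequency \<tau> \<delta>)"

end

theory Submission
  imports Defs "HOL-Real_Asymp.Real_Asymp"
begin

text \<open>
  Write \<open>L\<^sub>n = 2\<^sup>n l\<close>, and let \<open>F r\<close>, \<open>G r\<close> count the occurrences of \<open>\<delta>\<close> and of its reflection
  in the prefix of length \<open>r\<close>. Reflecting the prefix of length \<open>r \<le> L\<^sub>n\<close> onto the positions from
  \<open>L\<^sub>n\<close> on gives \<open>F (L\<^sub>n + r) = F L\<^sub>n + G r + O(|\<delta>|)\<close>, where the error counts the occurrences
  straddling position \<open>L\<^sub>n\<close>. Once \<open>|\<delta>| - 1 \<le> L\<^sub>n\<close>, the letters around \<open>L\<^sub>n\<^sub>+\<^sub>2\<close> are those around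
  \<open>L\<^sub>n\<close>, so for \<open>r = L\<^sub>n\<close> this error has period two in \<open>n\<close>. Hence, with the value of \<open>\<theta>\<close> given
  by the density formula, \<open>F L\<^sub>n + G L\<^sub>n - 2 \<theta> L\<^sub>n\<close> is also eventually periodic with period two, thus
  bounded, and peeling off the powers of two from \<open>r\<close> yields \<open>F r = \<theta> r + O(log r)\<close>.
\<close>

section \<open>Almost additive counting functions\<close>

lemma two_step_periodic_bounded:
  fixes b :: "nat \<Rightarrow> real"
  assumes "\<And>n. n \<ge> m \<Longrightarrow> b (n + 2) = b n"
  shows "\<exists>B. \<forall>n. \<bar>b n\<bar> \<le> B"
proof (intro exI allI)
  fix n
  \<comment> \<open>Periodicity carries every larger index back to \<open>m\<close> or
    \<open>m + 1\<close>, so the finitely many initial values bound all the others.\<close>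
  show "\<bar>b n\<bar> \<le> (\<Sum>i\<le>m+1. \<bar>b i\<bar>)"
  proof (induction n rule: less_induct)
    case (less n)
    show ?case
    proof (cases "n \<le> m + 1")
      case True
      then show ?thesis by (intro member_le_sum) auto
    next
      case False
      then have "n - 2 \<ge> m" "n - 2 + 2 = n" by auto
      then have "b n = b (n - 2)" using assms[of "n - 2"] by simp
      then show ?thesis using less.IH[of "n - 2"] False by simp
    qed
  qed
qed

text \<open>Every r >= 1 is at most 2^n l for some n <= log_2 r + 1, so the error is O(log r) and
  vanishes after division by r.\<close>

lemma logarithmic_error_tendsto:
  fixes F :: "nat \<Rightarrow> real" and \<theta> A C :: real
  assumes "l \<ge> (1::nat)" and "\<And>n r. r \<le> 2 ^ n * l \<Longrightarrow> \<bar>F r - \<theta> * r\<bar> \<le> A + n * C"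
  shows "(\<lambda>r. F r / r) \<longlonglongrightarrow> \<theta>"
proof -
  have bound: "norm (F r / r - \<theta>) \<le> (A + (log 2 r + 1) * \<bar>C\<bar>) / r" if "r \<ge> 1" for r :: nat
  proof -
    define n where "n = nat \<lceil>log 2 r\<rceil>"
    have log0: "log 2 r \<ge> 0" using that by simp
    have "real r = 2 powr (log 2 r)" using that by simp
    also have "\<dots> \<le> 2 powr real n" unfolding n_def using log0 by (intro powr_mono) auto
    finally have "real r \<le> real (2 ^ n)" by (simp add: powr_realpow)
    then have "r \<le> 2 ^ n" by (simp only: of_nat_le_iff)
    also have "\<dots> \<le> 2 ^ n * l" using assms(1) by simp
    finally have "\<bar>F r - \<theta> * r\<bar> \<le> A + n * C" by (rule assms(2))
    also have "n * C \<le> n * \<bar>C\<bar>" by (simp add: mult_left_mono)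
    also have "real n = of_int \<lceil>log 2 r\<rceil>" using log0 by (simp add: n_def)
    also have "\<dots> * \<bar>C\<bar> \<le> (log 2 r + 1) * \<bar>C\<bar>"
      by (intro mult_right_mono of_int_ceiling_le_add_one) simp
    finally have "\<bar>F r - \<theta> * r\<bar> \<le> A + (log 2 r + 1) * \<bar>C\<bar>" by simp
    moreover have "F r / r - \<theta> = (F r - \<theta> * r) / r" using that by (simp add: field_simps)
    ultimately show ?thesis using that by (simp add: divide_right_mono)
  qed
  have "(\<lambda>r::nat. (A + (log 2 r + 1) * \<bar>C\<bar>) / r) \<longlonglongrightarrow> 0" by real_asymp
  then have "(\<lambda>r. norm (F r / r - \<theta>)) \<longlonglongrightarrow> 0"
    by (rule tendsto_sandwich[OF _ _ tendsto_const, rotated 2])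
       (use bound in \<open>auto simp: eventually_at_top_linorder\<close>)
  then have "(\<lambda>r. F r / r - \<theta>) \<longlonglongrightarrow> 0" by (rule tendsto_norm_zero_cancel)
  then show ?thesis by (simp add: LIM_zero_iff)
qed

text \<open>Subtracting the linear function \<open>\<theta> * r\<close> preserves both splitting
  inequalities, so only the errors \<open>E\<close> and \<open>H\<close> need control. Their sum at
  \<open>L n\<close> is \<open>b n\<close>, which has period two from \<open>m\<close> on. This
  bounds both errors at all \<open>L n\<close>, and then, up to a term linear in n, at all r up to
  \<open>L n\<close>.\<close>

lemma almost_additive_tendsto:
  fixes F G :: "nat \<Rightarrow> real" and l m :: nat
  defines "L \<equiv> \<lambda>n. 2 ^ n * l"
  defines "a \<equiv> \<lambda>n. F (L n) + G (L n)"
  assumes l: "l \<ge> 1"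
    and F: "\<And>n r. r \<le> L n \<Longrightarrow> \<bar>F (L n + r) - F (L n) - G r\<bar> \<le> K"
    and G: "\<And>n r. r \<le> L n \<Longrightarrow> \<bar>G (L n + r) - G (L n) - F r\<bar> \<le> K"
    and per: "\<And>n. n \<ge> m \<Longrightarrow> a (n + 3) - 2 * a (n + 2) = a (n + 1) - 2 * a n"
  shows "(\<lambda>r. F r / r) \<longlonglongrightarrow> (a (m + 2) - a m) / (6 * real (L m))"
proof -
  define \<theta> where "\<theta> = (a (m + 2) - a m) / (6 * real (L m))"
  define E where "E r = F r - \<theta> * r" for r
  define H where "H r = G r - \<theta> * r" for r
  have L_Suc: "L (Suc n) = L n + L n" for n by (simp add: L_def)
  have "L m \<noteq> 0" using l by (simp add: L_def)
  define b where "b n = a n - 2 * \<theta> * L n" for n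
  have "b (n + 2) = b n" if "n \<ge> m" for n
    using that
  proof (induction n rule: dec_induct)
    case base
    \<comment> \<open>As \<open>L (m + 2) = 4 * L m\<close>, the demand
      \<open>b (m + 2) = b m\<close> reads \<open>a (m + 2) - a m = 6 * \<theta> * L m\<close>; this
      dictates \<open>\<theta>\<close> and the constant 6.\<close>
    have "a (m + 2) - a m = \<theta> * (6 * real (L m))" using \<open>L m \<noteq> 0\<close> by (simp add: \<theta>_def)
    moreover have "L (m + 2) = 4 * L m" by (simp add: L_Suc)
    ultimately show ?case by (simp add: b_def algebra_simps)
  next
    case (step n)
    have L: "L (n + 3) = 2 * L (n + 2)" "L (n + 1) = 2 * L n"
      by (simp_all add: L_Suc numeral_3_eq_3)
    \<comment> \<open>The linear terms cancel because \<open>L\<close> doubles at each step. With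
      the induction hypothesis, b(n+3) - b(n+1) = 2 (b(n+2) - b(n)) = 0.\<close>
    have "b (n + 3) - 2 * b (n + 2) = b (n + 1) - 2 * b n"
      using per[OF step(1)] unfolding b_def L by (simp add: algebra_simps)
    then show ?case using step by (simp add: numeral_3_eq_3)
  qed
  from two_step_periodic_bounded[of m b, OF this]
  obtain B where B: "\<bar>b n\<bar> \<le> B" for n by auto
  have K: "K \<ge> 0" using F[of 0 0] by simp
  have E_step: "\<bar>E (L n + r) - E (L n) - H r\<bar> \<le> K" if "r \<le> L n" for n r
    using F[OF that] by (simp add: E_def H_def algebra_simps)
  have H_step: "\<bar>H (L n + r) - H (L n) - E r\<bar> \<le> K" if "r \<le> L n" for n r
    using G[OF that] by (simp add: E_def H_def algebra_simps)
  have EH: "E (L n) + H (L n) = b n" for n by (simp add: E_def H_def b_def a_def)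
  define A where "A = (\<Sum>r\<le>l. \<bar>E r\<bar> + \<bar>H r\<bar>)"
  define C where "C = A + B + K"
  have A: "\<bar>E r\<bar> + \<bar>H r\<bar> \<le> A" if "r \<le> l" for r
    unfolding A_def by (rule member_le_sum[of r "{..l}" "\<lambda>r. \<bar>E r\<bar> + \<bar>H r\<bar>"]) (use that in auto)
  have A0: "A \<ge> 0" unfolding A_def by (intro sum_nonneg) auto
  have B0: "B \<ge> 0" using B[of 0] by linarith
  have C0: "C \<ge> 0" using K A0 B0 by (simp add: C_def)
  \<comment> \<open>For r = \<open>L k\<close>, both \<open>E (L (Suc k))\<close> and
    \<open>H (L (Suc k))\<close> differ from \<open>b k\<close> by at most \<open>K\<close>, so the
    bound on the sum controls each error separately.\<close>
  have C: "\<bar>E (L n)\<bar> \<le> C \<and> \<bar>H (L n)\<bar> \<le> C" for n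
  proof (cases n)
    case 0
    then show ?thesis using A[of l] K B0 unfolding C_def L_def 0 by (simp; linarith)
  next
    case (Suc k)
    then show ?thesis
      using E_step[of "L k" k] H_step[of "L k" k] EH[of k] B[of k] A0
      unfolding C_def Suc L_Suc by linarith
  qed
  \<comment> \<open>Each level removes a leading block of length \<open>L n\<close> from r and swaps
    \<open>E\<close> and \<open>H\<close> on the remainder, at a cost of at most
    \<open>C + K\<close>.\<close>
  have "\<bar>E r\<bar> \<le> A + n * (C + K) \<and> \<bar>H r\<bar> \<le> A + n * (C + K)" if "r \<le> L n" for n r
    using that
  proof (induction n arbitrary: r)
    case 0
    then show ?case using A[of r] unfolding L_def by (simp; linarith)
  next
    case (Suc n)
    have *: "real (Suc n) * (C + K) = n * (C + K) + (C + K)" by (simp add: algebra_simps)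
    show ?case
    proof (cases "r \<le> L n")
      case True
      then show ?thesis using Suc.IH[OF True] K C0 unfolding * by linarith
    next
      case False
      define s where "s = r - L n"
      have s: "r = L n + s" "s \<le> L n" using False Suc.prems by (auto simp: s_def L_Suc)
      show ?thesis
        using Suc.IH[OF s(2)] E_step[OF s(2)] H_step[OF s(2)] C[of n] unfolding * s(1) by linarith
    qed
  qed
  then have "(\<lambda>r. F r / r) \<longlonglongrightarrow> \<theta>"
    by (intro logarithmic_error_tendsto[OF l, of F \<theta> A "C + K"]) (auto simp: L_def E_def)
  then show ?thesis by (simp add: \<theta>_def)
qed

section \<open>Occurrences in the reflection sequence\<close>

lemma length_reflection [simp]: "length (reflection M w) = length w"
  by (simp add: reflection_def)

lemma reflection_reflection:
  assumes "set w \<subseteq> {..M}"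
  shows "reflection M (reflection M w) = w"
  using assms by (auto simp: reflection_def intro!: map_idI)

lemma set_reflection_subset: "set (reflection M w) \<subseteq> {..M}"
  by (auto simp: reflection_def)

lemma occurrences_seq_prefix:
  "occurrences \<delta> (seq_prefix \<tau> r) =
    card {i. i + length \<delta> \<le> r \<and> map \<tau> [i..<i + length \<delta>] = \<delta>}"
  unfolding occurrences_def seq_prefix_def
  by (rule arg_cong[of _ _ card], rule Collect_cong) (auto simp: drop_map take_map)

text \<open>Both inequalities at \<open>p\<close> are strict: a window ending at \<open>p\<close>
  lies wholly in the first block, one starting at \<open>p\<close> wholly in the second.\<close>

definition straddling :: "(nat \<Rightarrow> nat) \<Rightarrow> nat list \<Rightarrow> nat \<Rightarrow> nat \<Rightarrow> nat set" where
  "straddling \<tau> \<delta> p r =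
    {i. i < p \<and> p < i + length \<delta> \<and> i + length \<delta> \<le> p + r \<and> map \<tau> [i..<i + length \<delta>] = \<delta>}"

lemma card_straddling_le: "card (straddling \<tau> \<delta> p r) \<le> length \<delta>"
proof -
  have "straddling \<tau> \<delta> p r \<subseteq> {p - length \<delta>..<p}" by (auto simp: straddling_def)
  then have "card (straddling \<tau> \<delta> p r) \<le> card {p - length \<delta>..<p}" by (intro card_mono) auto
  then show ?thesis by simp
qed

text \<open>The block recursion in letterwise form. By \<open>letter_le\<close> the natural-number
  subtraction never truncates, so reflecting a letter twice restores it.\<close>

locale reflection_sequence =
  fixes M l :: nat and \<tau> :: "nat \<Rightarrow> nat"
  assumes l_pos: "l \<ge> 1"
    and initial_le: "i < l \<Longrightarrow> \<tau> i \<le> M"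
    and reflected: "i < 2 ^ n * l \<Longrightarrow> \<tau> (2 ^ n * l + i) = M - \<tau> i"
begin

lemma letter_le: "\<tau> i \<le> M"
proof -
  have "\<forall>i < 2 ^ n * l. \<tau> i \<le> M" for n
  proof (induction n)
    case 0
    then show ?case using initial_le by simp
  next
    case (Suc n)
    show ?case
    proof (intro allI impI)
      fix i assume "i < 2 ^ Suc n * l"
      then show "\<tau> i \<le> M"
        using Suc reflected[of "i - 2 ^ n * l" n] by (cases "i < 2 ^ n * l") auto
    qed
  qed
  moreover have "i < 2 ^ i * l" using l_pos less_exp[of i]
    by (metis less_le_trans mult.right_neutral mult_le_mono2)
  ultimately show ?thesis by blast
qed

lemma window_reflected:
  assumes "i + length \<delta> \<le> 2 ^ n * l" and "set \<delta> \<subseteq> {..M}"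
  shows "map \<tau> [2 ^ n * l + i..<2 ^ n * l + i + length \<delta>] = \<delta> \<longleftrightarrow>
    map \<tau> [i..<i + length \<delta>] = reflection M \<delta>"
proof -
  let ?w = "map \<tau> [i..<i + length \<delta>]"
  have "map \<tau> [2 ^ n * l + i..<2 ^ n * l + i + length \<delta>] = reflection M ?w"
    using assms(1) by (intro nth_equalityI)
      (auto simp: reflection_def reflected add.assoc)
  moreover have "reflection M (reflection M ?w) = ?w"
    using letter_le by (intro reflection_reflection) auto
  ultimately show ?thesis using reflection_reflection[OF assms(2)] by metis
qed

text \<open>A window ends by \<open>2 ^ n * l\<close>, starts there or later, or straddles that
  position. Shifting back turns windows of the second kind into occurrences of the reflected
  word.\<close>

lemma occurrences_split:
  assumes "r \<le> 2 ^ n * l" and "set \<delta> \<subseteq> {..M}" and "\<delta> \<noteq> []"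
  shows "occurrences \<delta> (seq_prefix \<tau> (2 ^ n * l + r)) =
    occurrences \<delta> (seq_prefix \<tau> (2 ^ n * l)) + occurrences (reflection M \<delta>) (seq_prefix \<tau> r) +
    card (straddling \<tau> \<delta> (2 ^ n * l) r)"
proof -
  let ?p = "2 ^ n * l" and ?k = "length \<delta>"
  let ?O = "\<lambda>\<delta> r. {i. i + length \<delta> \<le> r \<and> map \<tau> [i..<i + length \<delta>] = \<delta>}"
  let ?Y = "(\<lambda>i. ?p + i) ` ?O (reflection M \<delta>) r"
  let ?S = "straddling \<tau> \<delta> ?p r"
  have fin: "finite (?O \<delta>' s)" for \<delta>' s by (rule finite_subset[of _ "{..s}"]) auto
  have shift: "?p + i \<in> ?O \<delta> (?p + r) \<longleftrightarrow> i \<in> ?O (reflection M \<delta>) r" for i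
  proof (cases "i + ?k \<le> r")
    case True
    then show ?thesis using window_reflected[of i \<delta> n] assms by (simp add: add.assoc)
  qed simp
  have "?O \<delta> (?p + r) = (?O \<delta> ?p \<union> ?Y) \<union> ?S"
  proof (intro equalityI subsetI)
    fix i assume i: "i \<in> ?O \<delta> (?p + r)"
    show "i \<in> (?O \<delta> ?p \<union> ?Y) \<union> ?S"
    proof (cases "i < ?p")
      case True
      then show ?thesis using i by (auto simp: straddling_def)
    next
      case False
      then have eq: "?p + (i - ?p) = i" by simp
      then have "i - ?p \<in> ?O (reflection M \<delta>) r" using shift[of "i - ?p"] i by (simp only:)
      then have "i \<in> ?Y" unfolding image_iff by (rule bexI[where x = "i - ?p", rotated]) (simp only: eq)
      then show ?thesis by blast
    qed
  next
    fix i assume "i \<in> (?O \<delta> ?p \<union> ?Y) \<union> ?S"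
    then consider "i \<in> ?O \<delta> ?p" | "i \<in> ?Y" | "i \<in> ?S" by blast
    then show "i \<in> ?O \<delta> (?p + r)"
    proof cases
      case 2
      then show ?thesis using shift by blast
    qed (auto simp: straddling_def)
  qed
  \<comment> \<open>Nonemptiness gives disjointness: the empty word would occur at position
    \<open>?p\<close> in both of the first two sets.\<close>
  moreover have "?k > 0" using assms(3) by simp
  then have "?O \<delta> ?p \<inter> ?Y = {}" "(?O \<delta> ?p \<union> ?Y) \<inter> ?S = {}"
    by (auto simp: straddling_def)
  moreover have "finite ?S" by (rule finite_subset[of _ "{..?p}"]) (auto simp: straddling_def)
  moreover have "card ?Y = card (?O (reflection M \<delta>) r)" by (intro card_image) auto
  ultimately have "card (?O \<delta> (?p + r)) = card (?O \<delta> ?p) + card (?O (reflection M \<delta>) r) + card ?S"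
    using fin by (simp add: card_Un_disjoint del: length_reflection)
  then show ?thesis by (simp only: occurrences_seq_prefix)
qed

text \<open>Let W be the prefix of length p and W' its reflection. The sequence begins W W' W' W W'
  W W W', so the two blocks around 4p repeat the two blocks around p.\<close>

lemma letter_around_power:
  assumes "p = 2 ^ n * l" and "i < 2 * p"
  shows "\<tau> (3 * p + i) = \<tau> i"
proof -
  have q: "2 ^ Suc n * l = 2 * p" "2 ^ Suc (Suc n) * l = 4 * p" by (simp_all add: assms(1))
  have p: "\<tau> (p + j) = M - \<tau> j" if "j < p" for j
    using reflected[of j n] that by (simp add: assms(1))
  have p2: "\<tau> (2 * p + j) = M - \<tau> j" if "j < 2 * p" for j
    using reflected[of j "Suc n"] that unfolding q .
  have p4: "\<tau> (4 * p + j) = M - \<tau> j" if "j < 4 * p" for j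
    using reflected[of j "Suc (Suc n)"] that unfolding q .
  show ?thesis
  proof (cases "i < p")
    case True
    have "3 * p + i = 2 * p + (p + i)" by simp
    then have "\<tau> (3 * p + i) = M - (M - \<tau> i)" using p2[of "p + i"] p[of i] True by simp
    then show ?thesis using letter_le[of i] by simp
  next
    case False
    then obtain j where j: "i = p + j" "j < p" using assms(2) le_Suc_ex[of p i] by auto
    have "3 * p + i = 4 * p + j" using j(1) by simp
    then show ?thesis using p4[of j] p[of j] j by simp
  qed
qed

text \<open>By the length bound, a window straddling p stays inside [0, 2p) and one straddling 4p
  inside [3p, 5p). These stretches carry the same letters, so translation by 3p matches the two
  sets.\<close>

lemma card_straddling_periodic:
  assumes "length \<delta> - 1 \<le> 2 ^ n * l"
  shows "card (straddling \<tau> \<delta> (2 ^ (n + 2) * l) (2 ^ (n + 2) * l)) =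
    card (straddling \<tau> \<delta> (2 ^ n * l) (2 ^ n * l))"
proof -
  define p where "p = 2 ^ n * l"
  let ?k = "length \<delta>"
  have p4: "2 ^ (n + 2) * l = 4 * p" by (simp add: p_def)
  have window: "map \<tau> [3 * p + i..<3 * p + i + ?k] = map \<tau> [i..<i + ?k]" if "i < p" for i
    using that assms letter_around_power[OF p_def]
    by (intro nth_equalityI) (auto simp: p_def[symmetric] add.assoc)
  have shift: "3 * p + i \<in> straddling \<tau> \<delta> (4 * p) (4 * p) \<longleftrightarrow> i \<in> straddling \<tau> \<delta> p p" for i
    using window[of i] assms by (auto simp: straddling_def p_def[symmetric])
  have "straddling \<tau> \<delta> (4 * p) (4 * p) = (\<lambda>i. 3 * p + i) ` straddling \<tau> \<delta> p p"
  proof (intro equalityI subsetI)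
    fix i assume i: "i \<in> straddling \<tau> \<delta> (4 * p) (4 * p)"
    then have "i \<ge> 3 * p" using assms by (auto simp: straddling_def p_def[symmetric])
    then have "i = 3 * p + (i - 3 * p)" by simp
    then show "i \<in> (\<lambda>i. 3 * p + i) ` straddling \<tau> \<delta> p p"
      using shift[of "i - 3 * p"] i by (metis imageI)
  qed (use shift in blast)
  then show ?thesis unfolding p4 p_def[symmetric] by (simp add: card_image)
qed

lemma frequency_tendsto:
  fixes \<delta> :: "nat list"
  defines "a \<equiv> \<lambda>n. real (occurrences \<delta> (seq_prefix \<tau> (2 ^ n * l))
    + occurrences (reflection M \<delta>) (seq_prefix \<tau> (2 ^ n * l)))"
  assumes \<delta>: "set \<delta> \<subseteq> {..M}" "\<delta> \<noteq> []" and m: "length \<delta> - 1 \<le> 2 ^ m * l"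
  shows "frequency \<tau> \<delta> \<longlonglongrightarrow> (a (m + 2) - a m) / (6 * real (2 ^ m * l))"
proof -
  let ?\<rho> = "reflection M \<delta>"
  let ?F = "\<lambda>r. real (occurrences \<delta> (seq_prefix \<tau> r))"
  let ?G = "\<lambda>r. real (occurrences ?\<rho> (seq_prefix \<tau> r))"
  have \<rho>: "set ?\<rho> \<subseteq> {..M}" "?\<rho> \<noteq> []" "reflection M ?\<rho> = \<delta>"
    using \<delta> set_reflection_subset reflection_reflection by (auto simp: reflection_def)
  note splitF = occurrences_split[OF _ \<delta>] and splitG = occurrences_split[OF _ \<rho>(1,2), unfolded \<rho>(3)]
  have "(\<lambda>r. ?F r / r) \<longlonglongrightarrow>
    (?F (2 ^ (m + 2) * l) + ?G (2 ^ (m + 2) * l) - (?F (2 ^ m * l) + ?G (2 ^ m * l)))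
      / (6 * real (2 ^ m * l))"
  proof (rule almost_additive_tendsto[where F = ?F and G = ?G and l = l and m = m and K = "length \<delta>"])
    fix n r :: nat assume r: "r \<le> 2 ^ n * l"
    show "\<bar>?F (2 ^ n * l + r) - ?F (2 ^ n * l) - ?G r\<bar> \<le> length \<delta>"
      using splitF[OF r] card_straddling_le[of \<tau> \<delta> "2 ^ n * l" r] by simp
    show "\<bar>?G (2 ^ n * l + r) - ?G (2 ^ n * l) - ?F r\<bar> \<le> length \<delta>"
      using splitG[OF r] card_straddling_le[of \<tau> ?\<rho> "2 ^ n * l" r] by simp
  next
    show "l \<ge> 1" by (rule l_pos)
  next
    fix n assume "n \<ge> m"
    then have "2 ^ m * l \<le> 2 ^ n * l" by simp
    then have n: "length \<delta> - 1 \<le> 2 ^ n * l" "length ?\<rho> - 1 \<le> 2 ^ n * l"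
      unfolding length_reflection using m by linarith+
    \<comment> \<open>The defect of exact doubling from level n to level n + 1, summed over both
      words; its period two supplies the recurrence hypothesis on \<open>a\<close>.\<close>
    define e where "e n = real (card (straddling \<tau> \<delta> (2 ^ n * l) (2 ^ n * l))
      + card (straddling \<tau> ?\<rho> (2 ^ n * l) (2 ^ n * l)))" for n
    have step: "?F (2 ^ Suc n * l) + ?G (2 ^ Suc n * l) =
      2 * (?F (2 ^ n * l) + ?G (2 ^ n * l)) + e n" for n
    proof -
      have double: "2 ^ Suc n * l = 2 ^ n * l + 2 ^ n * l" by simp
      show ?thesis
        using splitF[of "2 ^ n * l" n] splitG[of "2 ^ n * l" n]
        unfolding double by (simp add: e_def)
    qed
    have "e (n + 2) = e n"
      unfolding e_def using card_straddling_periodic[OF n(1)] card_straddling_periodic[OF n(2)] by simp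
    moreover have "Suc (n + 2) = n + 3" "Suc n = n + 1" by simp_all
    ultimately show "?F (2 ^ (n + 3) * l) + ?G (2 ^ (n + 3) * l)
        - 2 * (?F (2 ^ (n + 2) * l) + ?G (2 ^ (n + 2) * l)) =
      ?F (2 ^ (n + 1) * l) + ?G (2 ^ (n + 1) * l) - 2 * (?F (2 ^ n * l) + ?G (2 ^ n * l))"
      using step[of "n + 2"] step[of n] by (simp only:)
  qed
  moreover have "frequency \<tau> \<delta> = (\<lambda>r. ?F r / r)" by (simp add: frequency_def fun_eq_iff)
  ultimately show ?thesis by (simp add: a_def)
qed

end

theorem theorem1p4:
  fixes M l :: nat and \<tau> :: "nat \<Rightarrow> nat" and \<delta> :: "nat list"
  assumes "M \<ge> 1" and "l \<ge> 1"
    and "\<forall>i<l. \<tau> i \<in> {0..M}"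
    and "\<forall>n. map \<tau> [2 ^ n * l..<2 ^ (n + 1) * l] = reflection M (seq_prefix \<tau> (2 ^ n * l))"
    and "\<delta> \<noteq> []" and "word_in \<delta> \<tau>"
  shows "has_density \<tau> \<delta> \<and> has_density \<tau> (reflection M \<delta>) \<and>
    (\<forall>n N P :: nat. 4 ^ n * l \<ge> length \<delta> - 1 \<longrightarrow>
       N = occurrences \<delta> (seq_prefix \<tau> (4 ^ n * l))
         + occurrences (reflection M \<delta>) (seq_prefix \<tau> (4 ^ n * l)) \<longrightarrow>
       P = occurrences \<delta> (seq_prefix \<tau> (4 ^ (n + 1) * l))
         + occurrences (reflection M \<delta>) (seq_prefix \<tau> (4 ^ (n + 1) * l)) \<longrightarrow>
       density \<tau> \<delta> = density \<tau> (reflection M \<delta>) \<and>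
       density \<tau> (reflection M \<delta>) = (real P - real N) / (6 * 4 ^ n * real l))"
proof -
  interpret reflection_sequence M l \<tau>
  proof
    fix i n :: nat assume i: "i < 2 ^ n * l"
    then have "2 ^ n * l + i < 2 ^ n * l + 2 ^ n * l" by (rule add_strict_left_mono)
    also have "\<dots> = 2 ^ (n + 1) * l" by simp
    finally have "2 ^ n * l + i < 2 ^ (n + 1) * l" .
    then have "\<tau> (2 ^ n * l + i) = map \<tau> [2 ^ n * l..<2 ^ (n + 1) * l] ! i"
      by (simp only: nth_map_upt less_diff_conv2 add.commute less_diff_conv)
    also have "\<dots> = M - \<tau> i"
      using assms(4) i by (simp add: reflection_def seq_prefix_def)
    finally show "\<tau> (2 ^ n * l + i) = M - \<tau> i" .
  qed (use assms in auto)
  let ?\<rho> = "reflection M \<delta>"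
  let ?a = "\<lambda>n. occurrences \<delta> (seq_prefix \<tau> (4 ^ n * l)) + occurrences ?\<rho> (seq_prefix \<tau> (4 ^ n * l))"
  let ?d = "\<lambda>n. (real (?a (n + 1)) - real (?a n)) / (6 * 4 ^ n * real l)"
  obtain j where "\<delta> = map \<tau> [j..<j + length \<delta>]" using assms(6) by (auto simp: word_in_def)
  then have \<delta>: "set \<delta> \<subseteq> {..M}" using letter_le by (metis atMost_iff ex_map_conv subsetI)
  have \<rho>: "set ?\<rho> \<subseteq> {..M}" "?\<rho> \<noteq> []" "reflection M ?\<rho> = \<delta>"
    using \<delta> assms(5) set_reflection_subset reflection_reflection by (auto simp: reflection_def)
  have pow: "2 ^ (2 * n) = (4::nat) ^ n" "2 ^ (2 * n + 2) = (4::nat) ^ (n + 1)" for n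
    by (simp_all add: power_mult)
  \<comment> \<open>Level \<open>2 * n\<close> turns powers of two into powers of four. The limit is
    symmetric in \<open>\<delta>\<close> and its reflection, so both frequencies share it.\<close>
  have tendsto: "frequency \<tau> \<delta> \<longlonglongrightarrow> ?d n" "frequency \<tau> ?\<rho> \<longlonglongrightarrow> ?d n"
    if n: "4 ^ n * l \<ge> length \<delta> - 1" for n
    using frequency_tendsto[OF \<delta> assms(5), of "2 * n"] frequency_tendsto[OF \<rho>(1,2), of "2 * n"] n
    unfolding pow \<rho>(3) by (simp_all add: mult.assoc add.commute)
  \<comment> \<open>Existence of the densities requires at least one admissible exponent; the length
    of \<open>\<delta>\<close> is one.\<close>
  have "length \<delta> - 1 \<le> 4 ^ length \<delta> * l"
  proof -
    have "length \<delta> \<le> 2 ^ length \<delta>" by (rule less_imp_le[OF less_exp])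
    also have "\<dots> \<le> 4 ^ length \<delta>" by (rule power_mono) simp_all
    also have "\<dots> \<le> 4 ^ length \<delta> * l" using assms(2) by simp
    finally show ?thesis by simp
  qed
  from tendsto[OF this, THEN convergentI] have "has_density \<tau> \<delta>" "has_density \<tau> ?\<rho>"
    unfolding has_density_def .
  moreover have "density \<tau> \<delta> = ?d n" "density \<tau> ?\<rho> = ?d n" if "4 ^ n * l \<ge> length \<delta> - 1" for n
    unfolding density_def using tendsto[OF that, THEN limI] .
  ultimately show ?thesis by (simp del: of_nat_add)
qed

end
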